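(* Let $(W,S)$ be a Coxeter system with length function $\ell$. The set $W$, together with the height function $\mathrm{ht}(w):=\ell(w)$ and the $W\times W$-action $(w',w'')w=w'w(w'')^{-1}$, is a quasiparabolic $W\times W$-set.
   Context: Coxeter systems $(W,S)$ have finite rank; $R(W)$ is the set of reflections, i.e. conjugates in $W$ of elements of $S$. A product $W\times W'$ of Coxeter groups is a Coxeter group with simple reflections $S\sqcup S'$ (each factor embedded in the obvious way). A scaled $W$-set is a pair $(X,\mathrm{ht})$ with $X$ a (left) $W$-set and $\mathrm{ht}:X\to\mathbb Z$ a function with $|\mathrm{ht}(sx)-\mathrm{ht}(x)|\le 1$ for all $s\in S$, $x\in X$. A quasiparabolic $W$-set is a scaled $W$-set such that (QP1) for all $r\in R(W)$, $x\in X$, if $\mathrm{ht}(rx)=\mathrm{ht}(x)$ then $rx=x$; and (QP2) for all $r\in R(W)$, $x\in X$, $s\in S$, if $\mathrm{ht}(rx)>\mathrm{ht}(x)$ and $\mathrm{ht}(srx)<\mathrm{ht}(sx)$, then $rx=sx$. *)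

theory Defs
  imports "HOL-Algebra.Group_Action" "HOL-Algebra.Generated_Groups" "HOL-Library.Extended_Nat"
begin

text \<open>
  Group presentations. Elements of the free group on \<open>S\<close> are represented by words in signed
  letters, where \<open>(s, True)\<close> stands for the generator \<open>s\<close> and \<open>(s, False)\<close> for its formal inverse.
  Inserting and deleting cancelling pairs and relators generates exactly the congruence whose
  quotient is the group with generators \<open>S\<close> and relators \<open>R\<close>.
\<close>

definition words :: "'a set \<Rightarrow> ('a \<times> bool) list set" where
  "words S = lists (S \<times> UNIV)"

inductive reduces_to :: "'a set \<Rightarrow> ('a \<times> bool) list set \<Rightarrow>
    ('a \<times> bool) list \<Rightarrow> ('a \<times> bool) list \<Rightarrow> bool" for S R where
  cancel: "\<lbrakk>u \<in> words S; v \<in> words S; s \<in> S\<rbrakk> \<Longrightarrow>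
    reduces_to S R (u @ [(s, b), (s, \<not> b)] @ v) (u @ v)"
| relator: "\<lbrakk>u \<in> words S; v \<in> words S; r \<in> R\<rbrakk> \<Longrightarrow> reduces_to S R (u @ r @ v) (u @ v)"

definition word_val :: "('a, 'b) monoid_scheme \<Rightarrow> ('a \<times> bool) list \<Rightarrow> 'a" where
  "word_val G w = foldr (\<lambda>(s, b) g. (if b then s else inv\<^bsub>G\<^esub> s) \<otimes>\<^bsub>G\<^esub> g) w \<one>\<^bsub>G\<^esub>"

text \<open>
  The last condition says that the canonical map from the presented group to \<open>G\<close> is well defined
  and injective; surjectivity is the condition that \<open>S\<close> generates \<open>G\<close>.
\<close>

definition has_presentation ::
    "('a, 'b) monoid_scheme \<Rightarrow> 'a set \<Rightarrow> ('a \<times> bool) list set \<Rightarrow> bool" where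
  "has_presentation G S R \<longleftrightarrow>
     S \<subseteq> carrier G \<and> R \<subseteq> words S \<and> generate G S = carrier G \<and>
     (\<forall>u\<in>words S. \<forall>v\<in>words S.
        word_val G u = word_val G v \<longleftrightarrow> equivclp (reduces_to S R) u v)"

definition coxeter_matrix :: "'a set \<Rightarrow> ('a \<Rightarrow> 'a \<Rightarrow> enat) \<Rightarrow> bool" where
  "coxeter_matrix S m \<longleftrightarrow>
     (\<forall>s\<in>S. m s s = 1) \<and>
     (\<forall>s\<in>S. \<forall>t\<in>S. m s t = m t s \<and> (s \<noteq> t \<longrightarrow> m s t \<ge> 2))"

text \<open>The relators \<open>(s t) ^ m(s, t)\<close>; there is none for a pair with \<open>m(s, t) = \<infinity>\<close>.\<close>

definition coxeter_relators :: "'a set \<Rightarrow> ('a \<Rightarrow> 'a \<Rightarrow> enat) \<Rightarrow> ('a \<times> bool) list set" where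
  "coxeter_relators S m =
     {concat (replicate k [(s, True), (t, True)]) | s t k. s \<in> S \<and> t \<in> S \<and> m s t = enat k}"

locale coxeter_system = group W for W (structure) +
  fixes S
  assumes finite_rank: "finite S"
    and coxeter_presentation:
      "\<exists>m. coxeter_matrix S m \<and> has_presentation W S (coxeter_relators S m)"

definition coxeter_length :: "('a, 'b) monoid_scheme \<Rightarrow> 'a set \<Rightarrow> 'a \<Rightarrow> nat" where
  "coxeter_length W S w =
     (LEAST n. \<exists>ss\<in>lists S. length ss = n \<and> w = foldr (\<otimes>\<^bsub>W\<^esub>) ss \<one>\<^bsub>W\<^esub>)"

definition reflections :: "('a, 'b) monoid_scheme \<Rightarrow> 'a set \<Rightarrow> 'a set" where
  "reflections W S = {w \<otimes>\<^bsub>W\<^esub> s \<otimes>\<^bsub>W\<^esub> inv\<^bsub>W\<^esub> w | w s. w \<in> carrier W \<and> s \<in> S}"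

text \<open>The disjoint union of the simple reflections of the two factors of \<open>W \<times>\<times> W'\<close>.\<close>

definition prod_simple_reflections ::
    "('a, 'b) monoid_scheme \<Rightarrow> 'a set \<Rightarrow> ('c, 'd) monoid_scheme \<Rightarrow> 'c set \<Rightarrow> ('a \<times> 'c) set" where
  "prod_simple_reflections W S W' S' =
     (\<lambda>s. (s, \<one>\<^bsub>W'\<^esub>)) ` S \<union> (\<lambda>s'. (\<one>\<^bsub>W\<^esub>, s')) ` S'"

locale scaled_W_set = coxeter_system W S + group_action W X act
  for W (structure) and S and X and act +
  fixes ht :: "'x \<Rightarrow> int"
  assumes scaled: "\<lbrakk>s \<in> S; x \<in> X\<rbrakk> \<Longrightarrow> \<bar>ht (act s x) - ht x\<bar> \<le> 1"

locale quasiparabolic_W_set = scaled_W_set W S X act ht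
  for W (structure) and S and X and act and ht +
  assumes QP1: "\<lbrakk>r \<in> reflections W S; x \<in> X; ht (act r x) = ht x\<rbrakk> \<Longrightarrow> act r x = x"
    and QP2: "\<lbrakk>r \<in> reflections W S; x \<in> X; s \<in> S;
        ht (act r x) > ht x; ht (act s (act r x)) < ht (act s x)\<rbrakk> \<Longrightarrow> act r x = act s x"

text \<open>
  The action of \<open>W \<times>\<times> W\<close> on \<open>W\<close>. As \<open>group_action\<close> maps into \<open>BijGroup\<close>, each element acts by a
  function that is extensional on the carrier.
\<close>

definition two_sided_action :: "('a, 'b) monoid_scheme \<Rightarrow> 'a \<times> 'a \<Rightarrow> 'a \<Rightarrow> 'a" where
  "two_sided_action W = (\<lambda>(w', w''). \<lambda>w\<in>carrier W. w' \<otimes>\<^bsub>W\<^esub> w \<otimes>\<^bsub>W\<^esub> inv\<^bsub>W\<^esub> w'')"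

end

theory Submission
  imports Defs
begin

text \<open>
  Write \<open>w = s\<^sub>1 \<cdots> s\<^sub>n\<close>. The parity of the number of indices \<open>i\<close> with
  \<open>r = s\<^sub>1 \<cdots> s\<^sub>i \<cdots> s\<^sub>1\<close> is unchanged by the Coxeter relations, hence depends only on \<open>w\<close>
  and \<open>r\<close>; for a reflection \<open>r\<close> it is odd iff \<open>\<ell>(r w) < \<ell>(w)\<close>. Replacing \<open>w\<close> by \<open>w s\<close> only
  changes it at \<open>r = w s w\<inverse>\<close>, which is (QP2) for a reflection acting on the left and a simple
  reflection acting on the right. Since \<open>x r\<inverse> = (x r\<inverse> x\<inverse>) x\<close> and \<open>\<ell>(w\<inverse>) = \<ell>(w)\<close>, the
  other cases reduce to this one.
\<close>

section \<open>Presentations of direct products\<close>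

lemma words_simps [simp]:
  "[] \<in> words S"
  "x # u \<in> words S \<longleftrightarrow> fst x \<in> S \<and> u \<in> words S"
  "u @ v \<in> words S \<longleftrightarrow> u \<in> words S \<and> v \<in> words S"
  by (auto simp: words_def mem_Times_iff)

lemma map_words:
  assumes "u \<in> words S" and "f ` S \<subseteq> T"
  shows "map (map_prod f id) u \<in> words T"
  using assms(1) by (induction u) (use assms(2) in auto)

text \<open>The surrounding words are absorbed into the contexts of a single cancellation or relator
  deletion; induction along the zigzag of moves does the rest.\<close>

lemma equivclp_reduces_to_context:
  assumes "equivclp (reduces_to S R) u v" and "a \<in> words S" and "b \<in> words S"
  shows "equivclp (reduces_to S R) (a @ u @ b) (a @ v @ b)"
proof -
  have lift: "reduces_to S R (a @ x @ b) (a @ y @ b)" if "reduces_to S R x y" for x y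
    using that
  proof cases
    case (cancel u v s c)
    then show ?thesis
      using reduces_to.cancel[of "a @ u" S "v @ b" s R c] assms by simp
  next
    case (relator u v r)
    then show ?thesis
      using reduces_to.relator[of "a @ u" S "v @ b" r R] assms by simp
  qed
  from assms(1) show ?thesis
  proof (induction rule: equivclp_induct)
    case base
    show ?case by simp
  next
    case (step y z)
    then show ?case
      using lift by (blast intro: equivclp_into_equivclp)
  qed
qed

text \<open>The route goes through \<open>u @ v'\<close>: first \<open>v\<close> is rewritten behind
  \<open>u\<close>, then \<open>u\<close> in front of \<open>v'\<close>. These two serve as
  contexts, which is why they are assumed to be words.\<close>

lemma equivclp_reduces_to_append:
  assumes "equivclp (reduces_to S R) u u'" and "equivclp (reduces_to S R) v v'"
    and "u \<in> words S" and "v' \<in> words S"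
  shows "equivclp (reduces_to S R) (u @ v) (u' @ v')"
proof -
  have "equivclp (reduces_to S R) (u @ v) (u @ v')"
    using equivclp_reduces_to_context[OF assms(2), of u "[]"] assms by simp
  also have "equivclp (reduces_to S R) (u @ v') (u' @ v')"
    using equivclp_reduces_to_context[OF assms(1), of "[]" v'] assms by simp
  finally (equivclp_trans) show ?thesis .
qed

text \<open>A map of letters that respects generators and relators induces a homomorphism of
  presented groups. It is applied to the embeddings of the two factors into the product.\<close>

lemma equivclp_reduces_to_map:
  assumes "equivclp (reduces_to S R) u v" and "f ` S \<subseteq> T"
    and "\<And>r. r \<in> R \<Longrightarrow> map (map_prod f id) r \<in> Q"
  shows "equivclp (reduces_to T Q) (map (map_prod f id) u) (map (map_prod f id) v)"
proof -
  have lift: "reduces_to T Q (map (map_prod f id) x) (map (map_prod f id) y)"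
    if "reduces_to S R x y" for x y
    using that
  proof cases
    case (cancel u v s c)
    then show ?thesis
      using reduces_to.cancel[of "map (map_prod f id) u" T "map (map_prod f id) v" "f s" Q c]
        map_words[OF _ assms(2)] assms(2) by auto
  next
    case (relator u v r)
    then show ?thesis
      using reduces_to.relator[of "map (map_prod f id) u" T "map (map_prod f id) v"
          "map (map_prod f id) r" Q] map_words[OF _ assms(2)] assms(3) by auto
  qed
  from assms(1) show ?thesis
  proof (induction rule: equivclp_induct)
    case base
    show ?case by simp
  next
    case (step y z)
    then show ?case
      using lift by (blast intro: equivclp_into_equivclp)
  qed
qed

text \<open>The word s^-1 s s reduces to s^-1 by deleting the relator s s, and to s by cancelling
  s^-1 s.\<close>

lemma involution_sign_irrelevant:
  assumes "s \<in> S" and "[(s, True), (s, True)] \<in> R"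
  shows "equivclp (reduces_to S R) [(s, b)] [(s, True)]"
proof (cases b)
  case False
  have 1: "reduces_to S R [(s, False), (s, True), (s, True)] [(s, False)]"
    using reduces_to.relator[of "[(s, False)]" S "[]" "[(s, True), (s, True)]" R] assms by simp
  have 2: "reduces_to S R [(s, False), (s, True), (s, True)] [(s, True)]"
    using reduces_to.cancel[of "[]" S "[(s, True)]" s R False] assms by simp
  show ?thesis
    using equivclp_trans[OF equivclp_sym[OF r_into_equivclp[of "reduces_to S R", OF 1]]
        r_into_equivclp[of "reduces_to S R", OF 2]] False by simp
qed simp

text \<open>Once signs are discarded, x x y x y y is reduced in two ways: deleting x x and then y y
  leaves y x, while deleting the inner x y x y leaves x y.\<close>

lemma involutions_commute:
  assumes "x \<in> S" and "y \<in> S"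
    and "[(x, True), (x, True)] \<in> R" and "[(y, True), (y, True)] \<in> R"
    and "[(x, True), (y, True), (x, True), (y, True)] \<in> R"
  shows "equivclp (reduces_to S R) [(y, c), (x, b)] [(x, b), (y, c)]"
proof -
  let ?E = "equivclp (reduces_to S R)" and ?X = "(x, True)" and ?Y = "(y, True)"
  have X: "?E [(x, b)] [?X]" and Y: "?E [(y, c)] [?Y]"
    using assms by (auto intro: involution_sign_irrelevant)
  have 1: "?E [?X, ?X, ?Y, ?X, ?Y, ?Y] [?Y, ?X, ?Y, ?Y]"
    using reduces_to.relator[of "[]" S "[?Y, ?X, ?Y, ?Y]" "[?X, ?X]" R] assms by (intro r_into_equivclp) simp
  have 2: "?E [?Y, ?X, ?Y, ?Y] [?Y, ?X]"
    using reduces_to.relator[of "[?Y, ?X]" S "[]" "[?Y, ?Y]" R] assms by (intro r_into_equivclp) simp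
  have 3: "?E [?X, ?X, ?Y, ?X, ?Y, ?Y] [?X, ?Y]"
    using reduces_to.relator[of "[?X]" S "[?Y]" "[?X, ?Y, ?X, ?Y]" R] assms by (intro r_into_equivclp) simp
  have YX: "?E [?Y, ?X] [?X, ?Y]"
    by (rule equivclp_trans[OF equivclp_sym[OF equivclp_trans[OF 1 2]] 3])
  have 4: "?E [(y, c), (x, b)] [?Y, ?X]"
    using equivclp_reduces_to_append[OF Y X] assms by simp
  have 5: "?E [(x, b), (y, c)] [?X, ?Y]"
    using equivclp_reduces_to_append[OF X Y] assms by simp
  show ?thesis
    by (rule equivclp_trans[OF 4 equivclp_trans[OF YX equivclp_sym[OF 5]]])
qed

text \<open>Serves to move a letter of the right factor past a whole word of the left
  factor.\<close>

lemma commute_past_word: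
  assumes "\<And>x. x \<in> set u \<Longrightarrow> equivclp (reduces_to S R) [y, x] [x, y]"
    and "u \<in> words S" and "fst y \<in> S"
  shows "equivclp (reduces_to S R) (y # u) (u @ [y])"
  using assms
proof (induction u)
  case (Cons x u)
  have x: "fst x \<in> S" and u: "u \<in> words S"
    using Cons.prems by simp_all
  have "equivclp (reduces_to S R) [y, x] [x, y]"
    by (rule Cons.prems) simp
  from equivclp_reduces_to_append[OF this equivclp_refl, of u]
  have "equivclp (reduces_to S R) (y # x # u) (x # y # u)"
    using x u Cons.prems(3) by simp
  moreover have "equivclp (reduces_to S R) (y # u) (u @ [y])"
    by (rule Cons.IH) (auto intro: Cons.prems simp: u)
  from equivclp_reduces_to_append[OF equivclp_refl this, of "[x]"]
  have "equivclp (reduces_to S R) (x # y # u) (x # u @ [y])"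
    using x u Cons.prems(3) by simp
  ultimately have "equivclp (reduces_to S R) (y # x # u) (x # u @ [y])"
    by (rule equivclp_trans)
  then show ?case
    by simp
qed simp

section \<open>Values of words in a group\<close>

context group
begin

lemma word_val_closed: "S \<subseteq> carrier G \<Longrightarrow> u \<in> words S \<Longrightarrow> word_val G u \<in> carrier G"
  by (induction u) (auto simp: word_val_def)

lemma word_val_append:
  assumes "S \<subseteq> carrier G" and "u \<in> words S" and "v \<in> words S"
  shows "word_val G (u @ v) = word_val G u \<otimes> word_val G v"
  using assms(2)
proof (induction u)
  case Nil
  then show ?case
    using word_val_closed[OF assms(1,3)] by (simp add: word_val_def)
next
  case (Cons x u)
  have "word_val G u \<in> carrier G" "word_val G v \<in> carrier G"
    using Cons.prems assms word_val_closed[OF assms(1)] by auto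
  then show ?case
    using Cons assms(1) by (cases x) (auto simp: word_val_def m_assoc)
qed

text \<open>Soundness of the moves: each one deletes a factor of value one.\<close>

lemma word_val_reduces_to:
  assumes "reduces_to S R u v" and "S \<subseteq> carrier G"
    and "R \<subseteq> words S" and "\<And>r. r \<in> R \<Longrightarrow> word_val G r = \<one>"
  shows "word_val G u = word_val G v"
  using assms(1)
proof cases
  case (cancel u v s b)
  have "word_val G [(s, b), (s, \<not> b)] = \<one>"
    using cancel assms(2) by (auto simp: word_val_def)
  then show ?thesis
    using cancel assms(2) word_val_append[OF assms(2), of u "[(s, b), (s, \<not> b)] @ v"]
      word_val_append[OF assms(2), of "[(s, b), (s, \<not> b)]" v]
      word_val_append[OF assms(2), of u v] word_val_closed[OF assms(2), of v] by simp
next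
  case (relator u v r)
  then show ?thesis
    using assms word_val_append[OF assms(2), of u "r @ v"]
      word_val_append[OF assms(2), of r v]
      word_val_append[OF assms(2), of u v] word_val_closed[OF assms(2), of v] by auto
qed

lemma word_val_equivclp:
  assumes "equivclp (reduces_to S R) u v" and "S \<subseteq> carrier G"
    and "R \<subseteq> words S" and "\<And>r. r \<in> R \<Longrightarrow> word_val G r = \<one>"
  shows "word_val G u = word_val G v"
  using assms(1)
  by (induction rule: equivclp_induct) (use word_val_reduces_to[OF _ assms(2-4)] in metis)+

lemma foldr_mult_closed:
  "S \<subseteq> carrier G \<Longrightarrow> u \<in> lists S \<Longrightarrow> foldr (\<otimes>) u \<one> \<in> carrier G"
  by (induction u) auto

lemma foldr_mult_append:
  assumes "S \<subseteq> carrier G" and "u \<in> lists S" and "v \<in> lists S"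
  shows "foldr (\<otimes>) (u @ v) \<one> = foldr (\<otimes>) u \<one> \<otimes> foldr (\<otimes>) v \<one>"
  using assms(2)
proof (induction u)
  case Nil
  then show ?case
    using foldr_mult_closed[OF assms(1,3)] by simp
next
  case (Cons x u)
  have "foldr (\<otimes>) u \<one> \<in> carrier G" "foldr (\<otimes>) v \<one> \<in> carrier G"
    using foldr_mult_closed[OF assms(1)] Cons.hyps assms by auto
  then show ?case
    using Cons assms(1) by (auto simp: m_assoc)
qed

end

section \<open>Reflections and length\<close>

context coxeter_system
begin

abbreviation word_prod :: "'a list \<Rightarrow> 'a" where
  "word_prod u \<equiv> foldr (\<otimes>) u \<one>"

lemma simple_closed [simp]: "s \<in> S \<Longrightarrow> s \<in> carrier W"
  and S_subset: "S \<subseteq> carrier W"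
  and generate_S: "generate W S = carrier W"
  using coxeter_presentation by (auto simp: has_presentation_def)

lemma relators_subset_words: "coxeter_relators S m \<subseteq> words S"
proof -
  have "concat (replicate k [(s, True), (t, True)]) \<in> words S" if "s \<in> S" "t \<in> S" for s t k
    using that by (induction k) auto
  then show ?thesis
    by (auto simp: coxeter_relators_def)
qed

text \<open>With empty contexts a relator reduces to the empty word in one move, so the presentation
  gives both the same value.\<close>

lemma word_val_relator:
  assumes "has_presentation W S R" and "r \<in> R"
  shows "word_val W r = \<one>"
proof -
  have "reduces_to S R r []"
    using reduces_to.relator[of "[]" S "[]" r R] assms by simp
  moreover have "r \<in> words S"
    using assms by (auto simp: has_presentation_def)
  ultimately have "word_val W r = word_val W []"
    using assms(1) unfolding has_presentation_def by (meson r_into_equivclp words_simps(1))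
  then show ?thesis
    by (simp add: word_val_def)
qed

lemma simple_square:
  assumes "s \<in> S"
  shows "s \<otimes> s = \<one>"
proof -
  obtain m where m: "coxeter_matrix S m" "has_presentation W S (coxeter_relators S m)"
    using coxeter_presentation by blast
  \<comment> \<open>The diagonal entry \<open>m s s = 1\<close> makes s s itself a relator.\<close>
  have "concat (replicate 1 [(s, True), (s, True)]) \<in> coxeter_relators S m"
    using m(1) assms unfolding coxeter_relators_def coxeter_matrix_def one_enat_def by blast
  from word_val_relator[OF m(2) this] show ?thesis
    using assms by (simp add: word_val_def)
qed

lemma simple_inv: "s \<in> S \<Longrightarrow> inv s = s"
  by (simp add: simple_square inv_equality)

lemma simple_cancel: "s \<in> S \<Longrightarrow> x \<in> carrier W \<Longrightarrow> s \<otimes> (s \<otimes> x) = x"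
  by (simp add: simple_square flip: m_assoc)

text \<open>Unsigned words suffice because simple reflections are their own inverses.\<close>

lemma word_prod_exists:
  assumes "w \<in> carrier W"
  shows "\<exists>u\<in>lists S. word_prod u = w"
proof -
  have "w \<in> generate W S"
    using assms generate_S by simp
  then show ?thesis
  proof (induction rule: generate.induct)
    case one
    show ?case
      by (rule bexI[of _ "[]"]) auto
  next
    case (incl h)
    then show ?case
      by (intro bexI[of _ "[h]"]) auto
  next
    case (inv h)
    then show ?case
      by (intro bexI[of _ "[h]"]) (auto simp: simple_inv)
  next
    case (eng g h)
    then obtain u v where "u \<in> lists S" "word_prod u = g" "v \<in> lists S" "word_prod v = h"
      by blast
    then show ?case
      using foldr_mult_append[OF S_subset] by (intro bexI[of _ "u @ v"]) auto
  qed
qed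

lemma word_prod_rev:
  assumes "u \<in> lists S"
  shows "word_prod (rev u) = inv (word_prod u)"
  using assms
proof (induction u)
  case (Cons s u)
  have "word_prod u \<in> carrier W"
    using Cons.hyps foldr_mult_closed[OF S_subset] by simp
  then show ?case
    using Cons foldr_mult_append[OF S_subset, of "rev u" "[s]"]
    by (auto simp: simple_inv inv_mult_group in_lists_conv_set)
qed simp

lemma length_le:
  "u \<in> lists S \<Longrightarrow> coxeter_length W S (word_prod u) \<le> length u"
  unfolding coxeter_length_def by (rule Least_le) blast

lemma reduced_word:
  assumes "w \<in> carrier W"
  obtains u where "u \<in> lists S" "word_prod u = w" "length u = coxeter_length W S w"
proof -
  have "\<exists>n. \<exists>u\<in>lists S. length u = n \<and> w = word_prod u"
    using word_prod_exists[OF assms] by blast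
  from LeastI_ex[OF this] show ?thesis
    using that unfolding coxeter_length_def by blast
qed

text \<open>Reversing a reduced word gives a word of the same length for the inverse. This yields
  one inequality, which is then applied to both \<open>w\<close> and its inverse.\<close>

lemma length_inv:
  assumes "w \<in> carrier W"
  shows "coxeter_length W S (inv w) = coxeter_length W S w"
proof -
  have le: "coxeter_length W S (inv x) \<le> coxeter_length W S x" if x: "x \<in> carrier W" for x
  proof -
    obtain u where "u \<in> lists S" "word_prod u = x" "length u = coxeter_length W S x"
      using reduced_word[OF x] .
    then show ?thesis
      using length_le[of "rev u"] word_prod_rev[of u] by (simp add: in_lists_conv_set)
  qed
  show ?thesis
    using le[OF assms] le[of "inv w"] assms by simp
qed

lemma length_mult_simple_le:
  assumes "s \<in> S" and "w \<in> carrier W"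
  shows "coxeter_length W S (s \<otimes> w) \<le> coxeter_length W S w + 1"
proof -
  obtain u where "u \<in> lists S" "word_prod u = w" "length u = coxeter_length W S w"
    using reduced_word[OF assms(2)] .
  then show ?thesis
    using length_le[of "s # u"] assms(1) by simp
qed

lemma length_simple_mult:
  assumes "s \<in> S" and "w \<in> carrier W"
  shows "\<bar>int (coxeter_length W S (s \<otimes> w)) - int (coxeter_length W S w)\<bar> \<le> 1"
  using length_mult_simple_le[OF assms] length_mult_simple_le[of s "s \<otimes> w"] assms
  by (simp add: simple_cancel)

lemma length_mult_simple:
  assumes "s \<in> S" and "w \<in> carrier W"
  shows "\<bar>int (coxeter_length W S (w \<otimes> s)) - int (coxeter_length W S w)\<bar> \<le> 1"
proof -
  have "coxeter_length W S (w \<otimes> s) = coxeter_length W S (s \<otimes> inv w)"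
    using length_inv[of "w \<otimes> s"] assms by (simp add: inv_mult_group simple_inv)
  then show ?thesis
    using length_simple_mult[of s "inv w"] length_inv assms by simp
qed

section \<open>Parity of a reflection in a word\<close>

text \<open>
  Whether \<open>r\<close> occurs an odd number of times among the elements
  \<open>s\<^sub>1 \<cdots> s\<^sub>i\<^sub>-\<^sub>1 s\<^sub>i s\<^sub>i\<^sub>-\<^sub>1 \<cdots> s\<^sub>1\<close>.
\<close>

primrec refl_parity :: "'a list \<Rightarrow> 'a \<Rightarrow> bool" where
  "refl_parity [] r = False"
| "refl_parity (s # u) r = ((r = s) \<noteq> refl_parity u (s \<otimes> r \<otimes> s))"

text \<open>Cocycle rule: the reflections of \<open>u @ v\<close> are those of \<open>u\<close>,
  followed by those of \<open>v\<close> conjugated by the product of \<open>u\<close>. Testing at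
  \<open>r\<close> moves the inverse conjugation onto the argument.\<close>

lemma refl_parity_append:
  assumes "u \<in> lists S" and "r \<in> carrier W"
  shows "refl_parity (u @ v) r =
    (refl_parity u r \<noteq> refl_parity v (inv (word_prod u) \<otimes> r \<otimes> word_prod u))"
  using assms
proof (induction u arbitrary: r)
  case (Cons s u)
  have "word_prod u \<in> carrier W"
    using Cons.hyps foldr_mult_closed[OF S_subset] by simp
  then have "inv (word_prod (s # u)) \<otimes> r \<otimes> word_prod (s # u) =
      inv (word_prod u) \<otimes> (s \<otimes> r \<otimes> s) \<otimes> word_prod u"
    using Cons.hyps Cons.prems by (simp add: inv_mult_group simple_inv m_assoc)
  then show ?case
    using Cons by auto
qed simp

lemma conj_simple_eq_iff:
  assumes "s \<in> S" and "r \<in> carrier W" and "x \<in> carrier W"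
  shows "s \<otimes> r \<otimes> s = x \<longleftrightarrow> r = s \<otimes> x \<otimes> s"
proof -
  have "s \<otimes> (s \<otimes> y \<otimes> s) \<otimes> s = y" if "y \<in> carrier W" for y
    using assms(1) that by (simp add: m_assoc simple_cancel simple_square)
  then show ?thesis
    using assms by metis
qed

lemma refl_parity_square:
  assumes "s \<in> S" and "r \<in> carrier W"
  shows "\<not> refl_parity [s, s] r"
  using conj_simple_eq_iff[of s r s] assms by (simp add: simple_square)

text \<open>Counting from 0, the letter at position \<open>j\<close> of s t s t ... contributes the
  reflection (s t)^j s; the sum counts occurrences of \<open>r\<close> with multiplicity.\<close>

lemma refl_parity_alternating:
  assumes "s \<in> S" and "t \<in> S" and "r \<in> carrier W"
  shows "refl_parity (concat (replicate k [s, t])) r =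
    odd (\<Sum>j<2 * k. of_bool (r = (s \<otimes> t) [^] j \<otimes> s) :: nat)"
  using assms(3)
proof (induction k arbitrary: r)
  case (Suc k)
  let ?f = "\<lambda>r (j::nat). of_bool (r = (s \<otimes> t) [^] j \<otimes> s) :: nat"
  let ?r' = "t \<otimes> (s \<otimes> r \<otimes> s) \<otimes> t"
  \<comment> \<open>The second letter contributes s t s, the term with index 1.\<close>
  have one: "s \<otimes> r \<otimes> s = t \<longleftrightarrow> r = (s \<otimes> t) [^] (1::nat) \<otimes> s"
    using assms Suc.prems by (simp add: conj_simple_eq_iff)
  \<comment> \<open>Removing the first two letters replaces \<open>r\<close> by its conjugate
    \<open>?r'\<close>, which shifts the index by two.\<close>
  have shift: "?f ?r' j = ?f r (Suc (Suc j))" for j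
  proof -
    have "?r' = (s \<otimes> t) [^] j \<otimes> s \<longleftrightarrow>
        r = s \<otimes> (t \<otimes> ((s \<otimes> t) [^] j \<otimes> s) \<otimes> t) \<otimes> s"
      using assms Suc.prems by (simp add: conj_simple_eq_iff)
    also have "s \<otimes> (t \<otimes> ((s \<otimes> t) [^] j \<otimes> s) \<otimes> t) \<otimes> s =
        ((s \<otimes> t) \<otimes> (s \<otimes> t) [^] j) \<otimes> (s \<otimes> t) \<otimes> s"
      using assms by (simp add: m_assoc)
    also have "(s \<otimes> t) \<otimes> (s \<otimes> t) [^] j = (s \<otimes> t) [^] Suc j"
      using assms by (metis m_closed nat_pow_Suc2 simple_closed)
    finally show ?thesis
      by simp
  qed
  have "(\<Sum>j<2 * Suc k. ?f r j) = ?f r 0 + ?f r 1 + (\<Sum>j<2 * k. ?f ?r' j)"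
    unfolding shift by (simp add: sum.lessThan_Suc_shift del: sum.lessThan_Suc nat_pow_Suc)
  moreover have "refl_parity (concat (replicate (Suc k) [s, t])) r =
      ((r = s) \<noteq> ((r = (s \<otimes> t) [^] (1::nat) \<otimes> s) \<noteq> refl_parity (concat (replicate k [s, t])) ?r'))"
    using one by simp
  moreover have "refl_parity (concat (replicate k [s, t])) ?r' = odd (\<Sum>j<2 * k. ?f ?r' j)"
    using Suc assms by simp
  ultimately show ?case
    using assms by (auto simp del: nat_pow_Suc)
qed simp

text \<open>Since (s t)^k is trivial, the reflections with indices j and k + j coincide, so each
  element occurs an even number of times among all 2k of them.\<close>

lemma refl_parity_relator:
  assumes "s \<in> S" and "t \<in> S" and "r \<in> carrier W" and "(s \<otimes> t) [^] k = \<one>"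
  shows "\<not> refl_parity (concat (replicate k [s, t])) r"
proof -
  let ?f = "\<lambda>j::nat. of_bool (r = (s \<otimes> t) [^] j \<otimes> s) :: nat"
  have period: "?f (k + j) = ?f j" for j
    using assms by (simp flip: nat_pow_mult)
  have "(\<Sum>j<2 * k. ?f j) = (\<Sum>j<k. ?f j) + (\<Sum>j<k. ?f (k + j))"
  proof -
    have "(\<Sum>j<k + n. ?f j) = (\<Sum>j<k. ?f j) + (\<Sum>j<n. ?f (k + j))" for n
      by (induction n) simp_all
    then show ?thesis
      by (simp add: mult_2)
  qed
  then have "even (\<Sum>j<2 * k. ?f j)"
    unfolding period by simp
  then show ?thesis
    using refl_parity_alternating[OF assms(1-3), of k] by blast
qed

lemma word_val_eq_word_prod:
  "u \<in> words S \<Longrightarrow> word_val W u = word_prod (map fst u)"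
  by (induction u) (auto simp: word_val_def simple_inv)

lemma words_map_fst: "u \<in> words S \<Longrightarrow> map fst u \<in> lists S"
  by (induction u) auto

text \<open>The factor \<open>q\<close> contributes nothing itself, and having product one it does
  not alter the conjugation under which \<open>v\<close> is tested.\<close>

lemma refl_parity_delete:
  assumes "u \<in> lists S" and "v \<in> lists S" and "q \<in> lists S" and "word_prod q = \<one>"
    and "\<And>x. x \<in> carrier W \<Longrightarrow> \<not> refl_parity q x" and "r \<in> carrier W"
  shows "refl_parity (u @ q @ v) r = refl_parity (u @ v) r"
proof -
  have "word_prod u \<in> carrier W"
    using assms foldr_mult_closed[OF S_subset] by simp
  then show ?thesis
    using assms by (simp add: refl_parity_append)
qed

text \<open>Forgetting signs turns a cancelling pair into s s and a relator into an alternating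
  word. Both have product one and even parity everywhere on the group, so they can be
  deleted.\<close>

lemma refl_parity_reduces_to:
  assumes "has_presentation W S (coxeter_relators S m)"
    and "reduces_to S (coxeter_relators S m) u v" and "r \<in> carrier W"
  shows "refl_parity (map fst u) r = refl_parity (map fst v) r"
  using assms(2)
proof cases
  case (cancel u v s b)
  then show ?thesis
    using refl_parity_delete[of "map fst u" "map fst v" "[s, s]" r] assms(3)
      refl_parity_square simple_square by (simp add: words_map_fst del: refl_parity.simps)
next
  case (relator u v q)
  then obtain s t k where q: "q = concat (replicate k [(s, True), (t, True)])"
    and st: "s \<in> S" "t \<in> S"
    by (auto simp: coxeter_relators_def)
  have fst_q: "map fst q = concat (replicate k [s, t])"
    unfolding q by (simp add: map_concat)
  have qw: "q \<in> words S"
    using relator(3-) relators_subset_words by blast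
  have val: "word_prod (concat (replicate k [s, t])) = (s \<otimes> t) [^] k" for k
  proof (induction k)
    case (Suc k)
    have "word_prod (concat (replicate (Suc k) [s, t])) = (s \<otimes> t) \<otimes> (s \<otimes> t) [^] k"
      using Suc st by (simp add: m_assoc)
    then show ?case
      using st by (metis m_closed nat_pow_Suc2 simple_closed)
  qed simp
  have "word_prod (map fst q) = \<one>"
    using word_val_relator[OF assms(1)] word_val_eq_word_prod[OF qw] relator by simp
  then show ?thesis
    using refl_parity_delete[of "map fst u" "map fst v" "map fst q" r] assms(3)
      refl_parity_relator[OF st, of _ k] relator words_map_fst[OF qw] val[of k]
    by (simp add: words_map_fst fst_q)
qed

text \<open>Completeness of the Coxeter presentation enters here: words with equal product are
  linked by moves, and each move preserves parity.\<close>

lemma refl_parity_cong: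
  assumes "u \<in> lists S" and "v \<in> lists S" and "word_prod u = word_prod v" and "r \<in> carrier W"
  shows "refl_parity u r = refl_parity v r"
proof -
  obtain m where m: "has_presentation W S (coxeter_relators S m)"
    using coxeter_presentation by blast
  \<comment> \<open>The presentation speaks of signed words, so unsigned ones are lifted with all
    signs positive.\<close>
  let ?p = "map (\<lambda>s. (s, True))"
  have p: "?p w \<in> words S" "map fst (?p w) = w" if "w \<in> lists S" for w
    using that by (induction w) auto
  have "word_val W (?p u) = word_val W (?p v)"
    using word_val_eq_word_prod p assms by metis
  then have "equivclp (reduces_to S (coxeter_relators S m)) (?p u) (?p v)"
    using m p assms unfolding has_presentation_def by blast
  then have "refl_parity (map fst (?p u)) r = refl_parity (map fst (?p v)) r"
    by (induction rule: equivclp_induct) (use refl_parity_reduces_to[OF m _ assms(4)] in metis)+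
  then show ?thesis
    using p assms by simp
qed

text \<open>Otherwise \<open>[\<one>]\<close> and \<open>[]\<close> would have equal products but
  different parities at one. In the product system this keeps the two families of generators
  apart.\<close>

lemma one_notin_S: "\<one> \<notin> S"
proof
  assume "\<one> \<in> S"
  then have "refl_parity [\<one>] \<one> = refl_parity [] \<one>"
    by (intro refl_parity_cong) auto
  then show False
    by simp
qed

text \<open>The exchange condition: odd parity makes \<open>r\<close> one of the reflections of
  \<open>u\<close>, and multiplying by it deletes the corresponding letter.\<close>

lemma refl_parity_exchange:
  assumes "u \<in> lists S" and "r \<in> carrier W" and "refl_parity u r"
  shows "\<exists>v\<in>lists S. word_prod v = r \<otimes> word_prod u \<and> length v < length u"
  using assms
proof (induction u arbitrary: r)
  case (Cons s u)
  have u: "word_prod u \<in> carrier W"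
    using Cons.hyps foldr_mult_closed[OF S_subset] by simp
  show ?case
  proof (cases "r = s")
    case True
    then show ?thesis
      using Cons.hyps u by (intro bexI[of _ u]) (auto simp: simple_cancel)
  next
    case False
    \<comment> \<open>Here the deleted letter lies in the tail, which has odd parity at s r s. As s
      (s r s) = r s, putting \<open>s\<close> back in front of the shortened tail gives
      \<open>r\<close> times the full product.\<close>
    then obtain v where v: "v \<in> lists S" "word_prod v = s \<otimes> r \<otimes> s \<otimes> word_prod u"
        "length v < length u"
      using Cons.IH[of "s \<otimes> r \<otimes> s"] Cons.hyps Cons.prems by auto
    then show ?thesis
      using Cons.hyps Cons.prems u
      by (intro bexI[of _ "s # v"]) (auto simp: m_assoc simple_cancel)
  qed
qed simp

section \<open>Reflections and their effect on length\<close>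

lemma reflection_closed: "r \<in> reflections W S \<Longrightarrow> r \<in> carrier W"
  by (auto simp: reflections_def)

lemma reflection_square: "r \<in> reflections W S \<Longrightarrow> r \<otimes> r = \<one>"
proof -
  assume "r \<in> reflections W S"
  then obtain w s where "w \<in> carrier W" "s \<in> S" "r = w \<otimes> s \<otimes> inv w"
    by (auto simp: reflections_def)
  then show ?thesis
    by (simp add: m_assoc inv_solve_left simple_cancel flip: m_assoc[of "inv w" w])
qed

lemma reflection_inv: "r \<in> reflections W S \<Longrightarrow> inv r = r"
  by (simp add: reflection_square reflection_closed inv_equality)

lemma reflection_conj:
  assumes "r \<in> reflections W S" and "x \<in> carrier W"
  shows "x \<otimes> r \<otimes> inv x \<in> reflections W S"
proof -
  obtain w s where w: "w \<in> carrier W" "s \<in> S" "r = w \<otimes> s \<otimes> inv w"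
    using assms by (auto simp: reflections_def)
  then have "x \<otimes> r \<otimes> inv x = (x \<otimes> w) \<otimes> s \<otimes> inv (x \<otimes> w)"
    using assms by (simp add: m_assoc inv_mult_group)
  then show ?thesis
    unfolding reflections_def using w assms by blast
qed

text \<open>Write r = w s w^-1 and take the palindrome \<open>a @ s # rev a\<close> with
  \<open>a\<close> a word for w. The contributions of \<open>a\<close> and \<open>rev a\<close>
  cancel, because \<open>a @ rev a\<close> has product one, and the middle letter contributes
  \<open>r\<close> once.\<close>

lemma reflection_word:
  assumes "r \<in> reflections W S"
  shows "\<exists>p\<in>lists S. word_prod p = r \<and> refl_parity p r"
proof -
  obtain w s where w: "w \<in> carrier W" and s: "s \<in> S" and r: "r = w \<otimes> s \<otimes> inv w"
    using assms by (auto simp: reflections_def)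
  obtain a where a: "a \<in> lists S" "word_prod a = w"
    using word_prod_exists[OF w] by blast
  have ra: "rev a \<in> lists S" "word_prod (rev a) = inv w"
    using a word_prod_rev by (auto simp: in_lists_conv_set)
  have [simp]: "r \<in> carrier W"
    using r w s by simp
  have conj: "inv w \<otimes> r \<otimes> w = s"
    using w s unfolding r by (simp add: m_assoc inv_solve_left')
  have "refl_parity (a @ rev a) r = refl_parity [] r"
    using a ra w foldr_mult_append[OF S_subset a(1) ra(1)] by (intro refl_parity_cong) auto
  then have "refl_parity a r = refl_parity (rev a) s"
    using a by (simp add: refl_parity_append conj)
  then have "refl_parity (a @ s # rev a) r"
    using a s by (simp add: refl_parity_append conj simple_square)
  moreover have "word_prod (a @ s # rev a) = r"
    using a ra s w r foldr_mult_append[OF S_subset, of a "s # rev a"] by (simp add: m_assoc)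
  ultimately show ?thesis
    using a s by (intro bexI[of _ "a @ s # rev a"]) auto
qed

text \<open>Parity depends only on the product, so \<open>u\<close> may be replaced by a reduced
  word; exchange then gives a strictly shorter word for the product multiplied by
  \<open>r\<close>.\<close>

lemma length_reflection_less:
  assumes "u \<in> lists S" and "r \<in> carrier W" and "refl_parity u r"
  shows "coxeter_length W S (r \<otimes> word_prod u) < coxeter_length W S (word_prod u)"
proof -
  have "word_prod u \<in> carrier W"
    using assms foldr_mult_closed[OF S_subset] by simp
  then obtain v where v: "v \<in> lists S" "word_prod v = word_prod u"
      "length v = coxeter_length W S (word_prod u)"
    using reduced_word by blast
  then have "refl_parity v r"
    using refl_parity_cong[of u v r] assms by simp
  then obtain z where "z \<in> lists S" "word_prod z = r \<otimes> word_prod v" "length z < length v"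
    using refl_parity_exchange v assms by blast
  then show ?thesis
    using length_le[of z] v by simp
qed

text \<open>Putting a word for \<open>r\<close> with odd parity at \<open>r\<close> in front of
  \<open>u\<close> makes the parity odd. Hence \<open>length_reflection_less\<close> applies to
  \<open>r\<close> times the product of \<open>u\<close>, and a second multiplication by
  \<open>r\<close> leads back.\<close>

lemma length_reflection_greater:
  assumes "u \<in> lists S" and "r \<in> reflections W S" and "\<not> refl_parity u r"
  shows "coxeter_length W S (word_prod u) < coxeter_length W S (r \<otimes> word_prod u)"
proof -
  have [simp]: "word_prod u \<in> carrier W" "r \<in> carrier W"
    using assms foldr_mult_closed[OF S_subset] reflection_closed by simp_all
  obtain p where p: "p \<in> lists S" "word_prod p = r" "refl_parity p r"
    using reflection_word[OF assms(2)] by blast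
  have "refl_parity (p @ u) r"
    using p assms by (simp add: refl_parity_append reflection_inv reflection_square)
  moreover have "word_prod (p @ u) = r \<otimes> word_prod u"
    using foldr_mult_append[OF S_subset p(1) assms(1)] p by simp
  ultimately have "coxeter_length W S (r \<otimes> (r \<otimes> word_prod u)) <
      coxeter_length W S (r \<otimes> word_prod u)"
    using length_reflection_less[of "p @ u" r] p assms by simp
  then show ?thesis
    using assms by (simp add: reflection_square flip: m_assoc)
qed

lemma length_reflection_neq:
  assumes "r \<in> reflections W S" and "x \<in> carrier W"
  shows "coxeter_length W S (r \<otimes> x) \<noteq> coxeter_length W S x"
  using word_prod_exists[OF assms(2)] length_reflection_less length_reflection_greater assms(1)
  by (metis less_irrefl reflection_closed)

text \<open>By the length conditions the parity at \<open>r\<close> is even for a word of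
  \<open>x\<close> and odd after appending \<open>s\<close>. The appended letter contributes only x
  s x^-1, which must therefore be \<open>r\<close>.\<close>

lemma reflection_simple_right:
  assumes "r \<in> reflections W S" and "x \<in> carrier W" and "s \<in> S"
    and "coxeter_length W S (r \<otimes> x) > coxeter_length W S x"
    and "coxeter_length W S (r \<otimes> x \<otimes> s) < coxeter_length W S (x \<otimes> s)"
  shows "r \<otimes> x = x \<otimes> s"
proof -
  obtain u where u: "u \<in> lists S" "word_prod u = x"
    using word_prod_exists[OF assms(2)] by blast
  have [simp]: "r \<in> carrier W"
    using assms(1) reflection_closed by simp
  have us: "u @ [s] \<in> lists S" "word_prod (u @ [s]) = x \<otimes> s"
    using foldr_mult_append[OF S_subset u(1), of "[s]"] u assms(3) by simp_all
  have "\<not> refl_parity u r"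
    using length_reflection_less[OF u(1), of r] u(2) assms(4) by auto
  moreover have "refl_parity (u @ [s]) r"
    using length_reflection_greater[OF us(1) assms(1)] us(2) assms by (auto simp: m_assoc)
  ultimately have "inv x \<otimes> r \<otimes> x = s"
    using u by (simp add: refl_parity_append)
  then have "x \<otimes> s = x \<otimes> (inv x \<otimes> (r \<otimes> x))"
    using assms(2) by (simp add: m_assoc)
  then show ?thesis
    using assms(2) by (simp add: inv_solve_left' flip: m_assoc)
qed

text \<open>Inversion preserves length and exchanges left and right multiplication, so
  \<open>reflection_simple_right\<close> is applied at the inverse of \<open>x\<close> with a
  conjugate of \<open>r\<close>.\<close>

lemma reflection_simple_left:
  assumes "r \<in> reflections W S" and "x \<in> carrier W" and "s \<in> S"
    and "coxeter_length W S (r \<otimes> x) > coxeter_length W S x"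
    and "coxeter_length W S (s \<otimes> (r \<otimes> x)) < coxeter_length W S (s \<otimes> x)"
  shows "r \<otimes> x = s \<otimes> x"
proof -
  have [simp]: "r \<in> carrier W"
    using assms(1) reflection_closed by simp
  \<comment> \<open>The unsimplified \<open>inv (inv x)\<close> matches the form of
    \<open>reflection_conj\<close>; this \<open>q\<close> is chosen so that multiplying
    \<open>inv x\<close> by it on the left gives the inverse of
    \<open>r \<otimes> x\<close>.\<close>
  define q where "q = inv x \<otimes> r \<otimes> inv (inv x)"
  have q: "q \<in> reflections W S"
    unfolding q_def using assms by (intro reflection_conj) auto
  have qx: "q \<otimes> inv x = inv (r \<otimes> x)"
    using assms by (simp add: q_def m_assoc inv_mult_group reflection_inv)
  have qxs: "inv (r \<otimes> x) \<otimes> s = inv (s \<otimes> (r \<otimes> x))" and xs: "inv x \<otimes> s = inv (s \<otimes> x)"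
    using assms by (simp_all add: inv_mult_group simple_inv)
  have "q \<otimes> inv x = inv x \<otimes> s"
    by (rule reflection_simple_right)
      (use assms q in \<open>simp_all only: qx qxs xs length_inv m_closed simple_closed inv_closed \<open>r \<in> carrier W\<close>\<close>)
  then have "inv (inv (r \<otimes> x)) = inv (inv (s \<otimes> x))"
    by (simp only: qx xs)
  then show ?thesis
    using assms by simp
qed

section \<open>The product system and its action\<close>

lemma DirProd_group: "group (W \<times>\<times> W)"
  by (intro DirProd_group) unfold_locales

abbreviation SS :: "('a \<times> 'a) set" where
  "SS \<equiv> prod_simple_reflections W S W S"

abbreviation left_word :: "('a \<times> bool) list \<Rightarrow> (('a \<times> 'a) \<times> bool) list" where
  "left_word \<equiv> map (map_prod (\<lambda>s. (s, \<one>)) id)"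

abbreviation right_word :: "('a \<times> bool) list \<Rightarrow> (('a \<times> 'a) \<times> bool) list" where
  "right_word \<equiv> map (map_prod (\<lambda>s. (\<one>, s)) id)"

lemma SS_subset: "SS \<subseteq> carrier (W \<times>\<times> W)"
  by (auto simp: prod_simple_reflections_def)

lemma image_SS: "(\<lambda>s. (s, \<one>)) ` S \<subseteq> SS" "(\<lambda>s. (\<one>, s)) ` S \<subseteq> SS"
  by (auto simp: prod_simple_reflections_def)

lemma left_word_words: "u \<in> words S \<Longrightarrow> left_word u \<in> words SS"
  by (rule map_words[OF _ image_SS(1)])

lemma right_word_words: "u \<in> words S \<Longrightarrow> right_word u \<in> words SS"
  by (rule map_words[OF _ image_SS(2)])

lemma word_val_left_word: "u \<in> words S \<Longrightarrow> word_val (W \<times>\<times> W) (left_word u) = (word_val W u, \<one>)"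
  by (induction u) (auto simp: word_val_def inv_DirProd[OF is_group is_group])

lemma word_val_right_word: "u \<in> words S \<Longrightarrow> word_val (W \<times>\<times> W) (right_word u) = (\<one>, word_val W u)"
  by (induction u) (auto simp: word_val_def inv_DirProd[OF is_group is_group])

lemma generate_SS: "generate (W \<times>\<times> W) SS = carrier (W \<times>\<times> W)"
proof (intro equalityI subsetI)
  fix g assume "g \<in> generate (W \<times>\<times> W) SS"
  then show "g \<in> carrier (W \<times>\<times> W)"
    using group.generate_in_carrier[OF DirProd_group SS_subset] by blast
next
  fix g assume "g \<in> carrier (W \<times>\<times> W)"
  then obtain w w' where g: "g = (w, w')" and w: "w \<in> carrier W" and w': "w' \<in> carrier W"
    by auto
  let ?H = "generate (W \<times>\<times> W) SS"
  have one: "(\<one>, \<one>) \<in> ?H"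
    using generate.one[of "W \<times>\<times> W" SS] by simp
  have mult: "(a \<otimes> c, b \<otimes> d) \<in> ?H" if "(a, b) \<in> ?H" "(c, d) \<in> ?H" for a b c d
    using generate.eng[OF that] by simp
  have left: "(s, \<one>) \<in> ?H" and right: "(\<one>, s) \<in> ?H" if "s \<in> S" for s
    using that by (auto intro!: generate.incl simp: prod_simple_reflections_def)
  have "(word_prod u, \<one>) \<in> ?H \<and> (\<one>, word_prod u) \<in> ?H" if "u \<in> lists S" for u
    using that
  proof (induction u)
    case (Cons s u)
    then show ?case
      using mult[OF left, of s "word_prod u" \<one>] mult[OF right, of s \<one> "word_prod u"] by simp
  qed (simp add: one)
  then have "(w, \<one>) \<in> ?H" "(\<one>, w') \<in> ?H"
    using word_prod_exists w w' by metis+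
  from mult[OF this] show "g \<in> ?H"
    using g w w' by simp
qed

section \<open>Coxeter matrix and presentation of the product\<close>

text \<open>The factor of a generator is recognised by which coordinate is one; this is unambiguous
  on \<open>SS\<close> because one is not simple. The entry 2 makes generators of different factors
  commute.\<close>

definition product_matrix :: "('a \<Rightarrow> 'a \<Rightarrow> enat) \<Rightarrow> 'a \<times> 'a \<Rightarrow> 'a \<times> 'a \<Rightarrow> enat" where
  "product_matrix m x y =
     (if snd x = \<one> \<and> snd y = \<one> then m (fst x) (fst y)
      else if fst x = \<one> \<and> fst y = \<one> then m (snd x) (snd y) else 2)"

lemma product_matrix_simps:
  assumes "s \<in> S" and "t \<in> S"
  shows "product_matrix m (s, \<one>) (t, \<one>) = m s t"
    and "product_matrix m (\<one>, s) (\<one>, t) = m s t"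
    and "product_matrix m (s, \<one>) (\<one>, t) = 2"
    and "product_matrix m (\<one>, s) (t, \<one>) = 2"
  using assms one_notin_S by (auto simp: product_matrix_def)

lemma coxeter_matrix_product:
  assumes "coxeter_matrix S m"
  shows "coxeter_matrix SS (product_matrix m)"
  using assms unfolding coxeter_matrix_def prod_simple_reflections_def
  by (auto simp: product_matrix_simps) blast+

lemma map_relator:
  "map (map_prod f id) (concat (replicate k [(s, True), (t, True)])) =
    concat (replicate k [(f s, True), (f t, True)])"
  by (simp add: map_concat)

lemma left_word_relator:
  "r \<in> coxeter_relators S m \<Longrightarrow> left_word r \<in> coxeter_relators SS (product_matrix m)"
  unfolding coxeter_relators_def prod_simple_reflections_def
  by (fastforce simp: map_relator product_matrix_simps)

lemma right_word_relator:
  "r \<in> coxeter_relators S m \<Longrightarrow> right_word r \<in> coxeter_relators SS (product_matrix m)"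
  unfolding coxeter_relators_def prod_simple_reflections_def
  by (fastforce simp: map_relator product_matrix_simps)

text \<open>A mixed pair gives a commutation relator of length four. It appears in two forms because
  relators are indexed by ordered pairs of generators.\<close>

lemma product_relator_cases:
  assumes "r \<in> coxeter_relators SS (product_matrix m)"
  obtains q where "q \<in> coxeter_relators S m" "r = left_word q"
  | q where "q \<in> coxeter_relators S m" "r = right_word q"
  | s t where "s \<in> S" "t \<in> S" "r = left_word [(s, True)] @ right_word [(t, True)] @
      left_word [(s, True)] @ right_word [(t, True)]"
  | s t where "s \<in> S" "t \<in> S" "r = right_word [(t, True)] @ left_word [(s, True)] @
      right_word [(t, True)] @ left_word [(s, True)]"
proof -
  obtain x y k where r: "r = concat (replicate k [(x, True), (y, True)])"
    and xy: "x \<in> SS" "y \<in> SS" and k: "product_matrix m x y = enat k"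
    using assms by (auto simp: coxeter_relators_def)
  have two: "k = 2" if "(2::enat) = enat k"
    using that by (simp add: numeral_eq_enat)
  from xy consider s t where "s \<in> S" "t \<in> S" "x = (s, \<one>)" "y = (t, \<one>)"
    | s t where "s \<in> S" "t \<in> S" "x = (\<one>, s)" "y = (\<one>, t)"
    | s t where "s \<in> S" "t \<in> S" "x = (s, \<one>)" "y = (\<one>, t)"
    | s t where "s \<in> S" "t \<in> S" "x = (\<one>, t)" "y = (s, \<one>)"
    by (auto simp: prod_simple_reflections_def)
  then show thesis
  proof cases
    case (1 s t)
    show thesis
      by (rule that(1)[of "concat (replicate k [(s, True), (t, True)])"])
        (use 1 k r in \<open>auto simp: coxeter_relators_def map_relator product_matrix_simps\<close>)
  next
    case (2 s t)
    show thesis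
      by (rule that(2)[of "concat (replicate k [(s, True), (t, True)])"])
        (use 2 k r in \<open>auto simp: coxeter_relators_def map_relator product_matrix_simps\<close>)
  next
    case (3 s t)
    then have "k = 2"
      using k two product_matrix_simps by metis
    then show thesis
      using that(3)[of s t] 3 r by (simp add: numeral_2_eq_2)
  next
    case (4 s t)
    then have "k = 2"
      using k two product_matrix_simps by metis
    then show thesis
      using that(4)[of s t] 4 r by (simp add: numeral_2_eq_2)
  qed
qed

lemma word_val_product_relator:
  assumes "has_presentation W S (coxeter_relators S m)"
    and "r \<in> coxeter_relators SS (product_matrix m)"
  shows "word_val (W \<times>\<times> W) r = \<one>\<^bsub>W \<times>\<times> W\<^esub>"
  using assms(2)
proof (cases rule: product_relator_cases)
  case (1 q)
  then show ?thesis
    using word_val_left_word[of q] word_val_relator[OF assms(1)] relators_subset_words by auto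
next
  case (2 q)
  then show ?thesis
    using word_val_right_word[of q] word_val_relator[OF assms(1)] relators_subset_words by auto
qed (simp_all add: word_val_def simple_square)

lemma product_relators_subset: "coxeter_relators SS (product_matrix m) \<subseteq> words SS"
proof
  fix r assume "r \<in> coxeter_relators SS (product_matrix m)"
  then show "r \<in> words SS"
  proof (cases rule: product_relator_cases)
    case (1 q)
    then show ?thesis
      using left_word_words relators_subset_words by blast
  next
    case (2 q)
    then show ?thesis
      using right_word_words relators_subset_words by blast
  qed (auto simp: prod_simple_reflections_def)
qed

lemma left_right_commute:
  assumes "coxeter_matrix S m" and "s \<in> S" and "t \<in> S"
  shows "equivclp (reduces_to SS (coxeter_relators SS (product_matrix m)))
    [((\<one>, t), c), ((s, \<one>), b)] [((s, \<one>), b), ((\<one>, t), c)]"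
proof (rule involutions_commute)
  have rel: "concat (replicate k [(x, True), (y, True)]) \<in> coxeter_relators SS (product_matrix m)"
    if "x \<in> SS" "y \<in> SS" "product_matrix m x y = enat k" for x y k
    using that unfolding coxeter_relators_def by blast
  show s: "(s, \<one>) \<in> SS" and t: "(\<one>, t) \<in> SS"
    using assms by (auto simp: prod_simple_reflections_def)
  have sq: "[(x, True), (x, True)] \<in> coxeter_relators SS (product_matrix m)" if "x \<in> SS" for x
    using rel[of x x 1] that coxeter_matrix_product[OF assms(1)]
    by (simp add: coxeter_matrix_def one_enat_def)
  show "[((s, \<one>), True), ((s, \<one>), True)] \<in> coxeter_relators SS (product_matrix m)"
    and "[((\<one>, t), True), ((\<one>, t), True)] \<in> coxeter_relators SS (product_matrix m)"
    using sq s t by blast+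
  show "[((s, \<one>), True), ((\<one>, t), True), ((s, \<one>), True), ((\<one>, t), True)]
      \<in> coxeter_relators SS (product_matrix m)"
    using rel[OF s t, of 2] assms product_matrix_simps(3)[of s t m]
    by (simp add: numeral_eq_enat numeral_2_eq_2)
qed

text \<open>Normal form: all letters of the left factor are collected in front. A new left letter
  simply extends \<open>a\<close>, while a new right letter is first carried past
  \<open>left_word a\<close> and then extends \<open>b\<close>.\<close>

lemma word_split:
  assumes "coxeter_matrix S m" and "u \<in> words SS"
  shows "\<exists>a\<in>words S. \<exists>b\<in>words S.
    equivclp (reduces_to SS (coxeter_relators SS (product_matrix m))) u
      (left_word a @ right_word b)"
  using assms(2)
proof (induction u)
  case Nil
  show ?case
    by (intro bexI[of _ "[]"]) auto
next
  case (Cons x u)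
  let ?E = "equivclp (reduces_to SS (coxeter_relators SS (product_matrix m)))"
  have "u \<in> words SS"
    using Cons.prems by simp
  then obtain a b where ab: "a \<in> words S" "b \<in> words S" "?E u (left_word a @ right_word b)"
    using Cons.IH by blast
  note lr = left_word_words[OF ab(1)] right_word_words[OF ab(2)]
  have xu: "?E (x # u) (x # left_word a @ right_word b)"
    using equivclp_reduces_to_append[of _ _ "[x]" "[x]", OF _ ab(3)] Cons.prems lr by simp
  obtain y c where "x = (y, c)" "y \<in> SS"
    using Cons.prems by (cases x) auto
  then consider s where "s \<in> S" "x = ((s, \<one>), c)" | s where "s \<in> S" "x = ((\<one>, s), c)"
    by (auto simp: prod_simple_reflections_def)
  then show ?case
  proof cases
    case (1 s)
    then have "?E (x # u) (left_word ((s, c) # a) @ right_word b)" "(s, c) # a \<in> words S"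
      using xu ab by simp_all
    then show ?thesis
      using ab(2) by blast
  next
    case (2 s)
    have "?E [x, z] [z, x]" if z: "z \<in> set (left_word a)" for z
    proof -
      have "a \<in> lists (S \<times> UNIV)"
        using ab by (simp add: words_def)
      with z obtain t d where "t \<in> S" "z = ((t, \<one>), d)"
        by auto
      then show ?thesis
        using left_right_commute[OF assms(1)] 2 by simp
    qed
    then have "?E (x # left_word a) (left_word a @ [x])"
      using lr Cons.prems by (intro commute_past_word) auto
    from equivclp_reduces_to_append[OF this, of "right_word b" "right_word b"]
    have "?E (x # left_word a @ right_word b) (left_word a @ right_word ((s, c) # b))"
      using lr Cons.prems 2 by simp
    then have "?E (x # u) (left_word a @ right_word ((s, c) # b))"
      by (rule equivclp_trans[OF xu])
    moreover have "(s, c) # b \<in> words S"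
      using ab(2) 2 by simp
    ultimately show ?thesis
      using ab(1) by blast
  qed
qed

text \<open>For completeness, split both words into a left and a right part. Equal values in the
  product mean equal values in each coordinate, so the presentation of the factor relates the parts,
  and the two embeddings carry these equivalences into the product.\<close>

lemma product_presentation:
  assumes "coxeter_matrix S m" and "has_presentation W S (coxeter_relators S m)"
  shows "has_presentation (W \<times>\<times> W) SS (coxeter_relators SS (product_matrix m))"
proof -
  let ?E = "equivclp (reduces_to SS (coxeter_relators SS (product_matrix m)))"
  interpret P: group "W \<times>\<times> W"
    by (rule DirProd_group)
  have sound: "word_val (W \<times>\<times> W) u = word_val (W \<times>\<times> W) v" if "?E u v" for u v
    using P.word_val_equivclp[OF that SS_subset product_relators_subset]
      word_val_product_relator[OF assms(2)] by blast
  have val: "word_val (W \<times>\<times> W) (left_word a @ right_word b) = (word_val W a, word_val W b)"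
    if "a \<in> words S" "b \<in> words S" for a b
    using that P.word_val_append[OF SS_subset left_word_words right_word_words]
      word_val_closed[OF S_subset]
    by (simp add: word_val_left_word word_val_right_word)
  have complete: "?E u v"
    if u: "u \<in> words SS" and v: "v \<in> words SS"
      and eq: "word_val (W \<times>\<times> W) u = word_val (W \<times>\<times> W) v" for u v
  proof -
    obtain a b where ab: "a \<in> words S" "b \<in> words S" "?E u (left_word a @ right_word b)"
      using word_split[OF assms(1) u] by blast
    obtain a' b' where ab': "a' \<in> words S" "b' \<in> words S" "?E v (left_word a' @ right_word b')"
      using word_split[OF assms(1) v] by blast
    have "word_val W a = word_val W a'" "word_val W b = word_val W b'"
      using eq sound[OF ab(3)] sound[OF ab'(3)] val ab ab' by auto
    then have "equivclp (reduces_to S (coxeter_relators S m)) a a'"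
        "equivclp (reduces_to S (coxeter_relators S m)) b b'"
      using assms(2) ab ab' unfolding has_presentation_def by auto
    then have "?E (left_word a) (left_word a')" "?E (right_word b) (right_word b')"
      using equivclp_reduces_to_map[OF _ image_SS(1) left_word_relator]
        equivclp_reduces_to_map[OF _ image_SS(2) right_word_relator] by blast+
    then have "?E (left_word a @ right_word b) (left_word a' @ right_word b')"
      using ab ab' by (intro equivclp_reduces_to_append left_word_words right_word_words)
    then show ?thesis
      using equivclp_trans[OF ab(3) equivclp_trans[OF _ equivclp_sym[OF ab'(3)]]] by blast
  qed
  show ?thesis
    unfolding has_presentation_def
    using SS_subset product_relators_subset generate_SS sound complete by blast
qed

lemma coxeter_system_product: "coxeter_system (W \<times>\<times> W) SS"
proof -
  interpret P: group "W \<times>\<times> W"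
    by (rule DirProd_group)
  show ?thesis
  proof unfold_locales
    show "finite SS"
      using finite_rank by (simp add: prod_simple_reflections_def)
    show "\<exists>m. coxeter_matrix SS m \<and> has_presentation (W \<times>\<times> W) SS (coxeter_relators SS m)"
      using coxeter_presentation coxeter_matrix_product product_presentation by blast
  qed
qed

section \<open>The two-sided action and its quasiparabolicity\<close>

lemma two_sided_action_apply:
  "x \<in> carrier W \<Longrightarrow> two_sided_action W (a, b) x = a \<otimes> x \<otimes> inv b"
  by (simp add: two_sided_action_def)

lemma group_action_two_sided: "group_action (W \<times>\<times> W) (carrier W) (two_sided_action W)"
proof -
  have bij: "two_sided_action W (a, b) \<in> Bij (carrier W)"
    if "a \<in> carrier W" "b \<in> carrier W" for a b
  proof -
    have "bij_betw (two_sided_action W (a, b)) (carrier W) (carrier W)"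
      \<comment> \<open>The inverse bijection is the action of the inverse pair.\<close>
      by (rule bij_betw_byWitness[where f' = "two_sided_action W (inv a, inv b)"])
        (use that in \<open>auto simp: two_sided_action_apply m_assoc inv_solve_left'
          simp flip: m_assoc[of a "inv a"] m_assoc[of "inv a" a]\<close>)
    then show ?thesis
      by (simp add: Bij_def two_sided_action_def)
  qed
  have hom: "two_sided_action W \<in> hom (W \<times>\<times> W) (BijGroup (carrier W))"
  proof (rule homI)
    fix g assume "g \<in> carrier (W \<times>\<times> W)"
    then show "two_sided_action W g \<in> carrier (BijGroup (carrier W))"
      using bij by (auto simp: BijGroup_def)
  next
    fix g h assume "g \<in> carrier (W \<times>\<times> W)" "h \<in> carrier (W \<times>\<times> W)"
    then obtain a b c d where gh: "g = (a, b)" "h = (c, d)"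
      and [simp]: "a \<in> carrier W" "b \<in> carrier W" "c \<in> carrier W" "d \<in> carrier W"
      by auto
    have "two_sided_action W (a \<otimes> c, b \<otimes> d) =
        compose (carrier W) (two_sided_action W (a, b)) (two_sided_action W (c, d))"
      \<comment> \<open>Outside the carrier both sides are \<open>undefined\<close>, since
        \<open>compose\<close> and the action are restricted to it.\<close>
      by (rule ext)
        (simp add: compose_def two_sided_action_def m_assoc inv_mult_group)
    then show "two_sided_action W (g \<otimes>\<^bsub>W \<times>\<times> W\<^esub> h) =
        two_sided_action W g \<otimes>\<^bsub>BijGroup (carrier W)\<^esub> two_sided_action W h"
      using gh bij by (simp add: BijGroup_def)
  qed
  show ?thesis
    unfolding group_action_def group_hom_def group_hom_axioms_def
    using DirProd_group group_BijGroup hom by blast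
qed

lemma simple_action_cases:
  assumes "g \<in> SS"
  obtains s where "s \<in> S" "\<And>x. x \<in> carrier W \<Longrightarrow> two_sided_action W g x = s \<otimes> x"
  | s where "s \<in> S" "\<And>x. x \<in> carrier W \<Longrightarrow> two_sided_action W g x = x \<otimes> s"
  using assms by (auto simp: prod_simple_reflections_def two_sided_action_apply simple_inv)

text \<open>A reflection of the product is nontrivial in only one coordinate. In the second
  coordinate it multiplies \<open>x\<close> on the right, which is left multiplication by a
  conjugate, so the reflection \<open>r\<close> found may depend on \<open>x\<close>.\<close>

lemma reflection_action:
  assumes "g \<in> reflections (W \<times>\<times> W) SS" and "x \<in> carrier W"
  shows "\<exists>r\<in>reflections W S. two_sided_action W g x = r \<otimes> x"
proof -
  obtain a b y where ab: "a \<in> carrier W" "b \<in> carrier W" and y: "y \<in> SS"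
    and g: "g = (a, b) \<otimes>\<^bsub>W \<times>\<times> W\<^esub> y \<otimes>\<^bsub>W \<times>\<times> W\<^esub> inv\<^bsub>W \<times>\<times> W\<^esub> (a, b)"
    using assms(1) unfolding reflections_def by auto
  from y consider s where "s \<in> S" "y = (s, \<one>)" | s where "s \<in> S" "y = (\<one>, s)"
    by (auto simp: prod_simple_reflections_def)
  then show ?thesis
  proof cases
    case (1 s)
    then have "g = (a \<otimes> s \<otimes> inv a, \<one>)"
      using g ab by (simp add: inv_DirProd[OF is_group is_group])
    moreover have "a \<otimes> s \<otimes> inv a \<in> reflections W S"
      using ab 1 by (auto simp: reflections_def)
    ultimately show ?thesis
      using assms(2) ab 1 by (auto simp: two_sided_action_apply)
  next
    case (2 s)
    define r where "r = b \<otimes> s \<otimes> inv b"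
    have r: "r \<in> reflections W S"
      using ab 2 by (auto simp: reflections_def r_def)
    have "g = (\<one>, r)"
      using g ab 2 by (simp add: inv_DirProd[OF is_group is_group] r_def)
    then have "two_sided_action W g x = (x \<otimes> r \<otimes> inv x) \<otimes> x"
      using r assms(2)
      by (simp add: two_sided_action_apply reflection_inv reflection_closed m_assoc)
    then show ?thesis
      using reflection_conj[OF r assms(2)] by blast
  qed
qed

lemma quasiparabolic_two_sided:
  "quasiparabolic_W_set (W \<times>\<times> W) SS (carrier W) (two_sided_action W)
    (\<lambda>w. int (coxeter_length W S w))"
proof -
  interpret P: coxeter_system "W \<times>\<times> W" SS
    by (rule coxeter_system_product)
  interpret A: group_action "W \<times>\<times> W" "carrier W" "two_sided_action W"
    by (rule group_action_two_sided)
  show ?thesis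
  proof unfold_locales
    fix g x assume "g \<in> SS" and x: "x \<in> carrier W"
    then show "\<bar>int (coxeter_length W S (two_sided_action W g x)) -
        int (coxeter_length W S x)\<bar> \<le> 1"
      by (cases rule: simple_action_cases)
        (simp_all add: length_simple_mult length_mult_simple)
  next
    fix g x assume "g \<in> reflections (W \<times>\<times> W) SS" and x: "x \<in> carrier W"
      and eq: "int (coxeter_length W S (two_sided_action W g x)) = int (coxeter_length W S x)"
    \<comment> \<open>(QP1) holds vacuously: left multiplication by a reflection always changes the
      length.\<close>
    then show "two_sided_action W g x = x"
      using reflection_action length_reflection_neq by (metis of_nat_eq_iff)
  next
    fix g x h
    assume g: "g \<in> reflections (W \<times>\<times> W) SS" and x: "x \<in> carrier W" and h: "h \<in> SS"
      and up: "int (coxeter_length W S x) < int (coxeter_length W S (two_sided_action W g x))"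
      and down: "int (coxeter_length W S (two_sided_action W h (two_sided_action W g x)))
        < int (coxeter_length W S (two_sided_action W h x))"
    \<comment> \<open>With \<open>g\<close> replaced by a left reflection suited to this
      \<open>x\<close>, only the side on which \<open>h\<close> multiplies remains to be
      distinguished.\<close>
    obtain r where r: "r \<in> reflections W S" and gx: "two_sided_action W g x = r \<otimes> x"
      using reflection_action[OF g x] by blast
    have rx: "r \<otimes> x \<in> carrier W"
      using reflection_closed[OF r] x by simp
    from h show "two_sided_action W g x = two_sided_action W h x"
    proof (cases rule: simple_action_cases)
      case (1 s)
      then show ?thesis
        using reflection_simple_left[OF r x] up down x rx by (simp add: gx)
    next
      case (2 s)
      then show ?thesis
        using reflection_simple_right[OF r x] up down x rx by (simp add: gx)
    qed
  qed
qed

end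

theorem theorem3p1:
  fixes W :: "('a, 'b) monoid_scheme" and S :: "'a set"
  assumes "coxeter_system W S"
  shows "quasiparabolic_W_set (W \<times>\<times> W) (prod_simple_reflections W S W S)
           (carrier W) (two_sided_action W) (\<lambda>w. int (coxeter_length W S w))"
  using assms by (rule coxeter_system.quasiparabolic_two_sided)

end
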